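(* Consider a natural gas network on a connected directed graph $\mathcal{G}=(\mathcal{N},\mathcal{P})$ with lossy pipes $\bar{\mathcal{P}}_a$ and compressors $\mathcal{P}_a$, and suppose the gas flow problem is feasible. Assume that there is a single fixed-pressure node, $\mathcal{N}_\psi=\{r\}$, that each edge of the network belongs to at most one cycle, and that no compressor lies on a cycle. Then the triplet $(\mathbf{q},\boldsymbol{\phi},\boldsymbol{\psi})$ of any minimizer of the relaxed mixed-integer problem (G2) solves the gas flow problem.
   Context: Network. $\mathcal{G}=(\mathcal{N},\mathcal{P})$ is a finite directed graph, connected when edge directions are ignored, with $\mathcal{N}=\{1,\dots,N\}$ and $P$ edges; if $(m,n)\in\mathcal{P}$ then $(n,m)\notin\mathcal{P}$. The edge set is partitioned as $\mathcal{P}=\mathcal{P}_a\cup\bar{\mathcal{P}}_a$, with $\mathcal{P}_a$ the ideal compressors (factors $\alpha_\ell>0$) and $\bar{\mathcal{P}}_a$ the lossy pipes (coefficients $a_\ell>0$). The edge-node incidence matrix $\mathbf{A}\in\mathbb{R}^{P\times N}$ has, in the row of $\ell=(m,n)$, entry $+1$ in column $m$, $-1$ in column $n$, and $0$ elsewhere. Compressor convention. Every ideal compressor $(m,n)\in\mathcal{P}_a$ is followed by a lossy pipe: its head node $n$ is an internal junction node whose only incident edges are the compressor $(m,n)$ and one lossy pipe $(n,n')\in\bar{\mathcal{P}}_a$, and its injection is fixed to $q_n=0$. Cycles. A cycle is a closed sequence of adjacent edges (ignoring edge directions) without node or edge repetition. A cycle is active if it contains at least one compressor. Gas flow problem. The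 set $\mathcal{N}_\psi$ consists of the nodes with given pressures and $\mathcal{N}_q=\mathcal{N}\setminus\mathcal{N}_\psi$ of those with given injections. Find injections $\mathbf{q}\in\mathbb{R}^N$, flows $\boldsymbol{\phi}\in\mathbb{R}^P$ and (squared) pressures $\boldsymbol{\psi}\in\mathbb{R}^N$ agreeing with the given $\{\psi_n\}_{n\in\mathcal{N}_\psi}$, $\{q_n\}_{n\in\mathcal{N}_q}$ and such that: (i) $\mathbf{A}^\top\boldsymbol{\phi}=\mathbf{q}$; (ii) $\psi_m-\psi_n=a_\ell\,\mathrm{sign}(\phi_\ell)\phi_\ell^2$ for every $\ell=(m,n)\in\bar{\mathcal{P}}_a$, and $\psi_n\ge0$ for all $n$; (iii) $\psi_n=\alpha_\ell\psi_m$ and $\phi_\ell\ge0$ for every $\ell=(m,n)\in\mathcal{P}_a$. Problem (G2). Constants $\underline{\psi}_n\le\overline{\psi}_n$ (with $\underline\psi_n\ge 0$) and $\overline{\phi}_\ell$ are given bounds, valid for the gas flow solution: $\underline{\psi}_n\le\psi_n\le\overline{\psi}_n$ and $|\phi_\ell|\le\overline{\phi}_\ell$. With binary variables $x_\ell\in\{0,1\}$, $\ell\in\bar{\mathcal{P}}_a$, and auxiliary variables $z_{\ell m},z_{\ell n}$ for each $\ell=(m,n)\in\bar{\mathcal{P}}_a$, problem (G2) minimizes $$r(\boldsymbol{\psi})=\sum_{(m,n)}|\psi_m-\psi_n|,$$ the sum running over all lossy pipes $(m,n)\in\bar{\mathcal{P}}_a$ that belong to no active cycle, over $\mathbf{q},\boldsymbol{\phi},\boldsymbol{\psi},\mathbf{x}$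 (and the $z$'s), with the given $\{\psi_n\}_{n\in\mathcal{N}_\psi}$, $\{q_n\}_{n\in\mathcal{N}_q}$ fixed, subject to (i), (iii), and for every $\ell=(m,n)\in\bar{\mathcal{P}}_a$: - for each endpoint $k\in\{m,n\}$: $x_\ell\underline{\psi}_k\le z_{\ell k}\le x_\ell\overline{\psi}_k$ and $\psi_k+(x_\ell-1)\overline{\psi}_k\le z_{\ell k}\le\psi_k+(x_\ell-1)\underline{\psi}_k$ (equivalently $z_{\ell k}=x_\ell\psi_k$ with $\underline\psi_k\le\psi_k\le\overline\psi_k$); - $2z_{\ell m}-2z_{\ell n}+\psi_n-\psi_m\ge a_\ell\phi_\ell^2$; - $-\overline{\phi}_\ell(1-x_\ell)\le\phi_\ell\le\overline{\phi}_\ell x_\ell$. *)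

theory Defs
  imports Complex_Main "Graph_Theory.Digraph_Component"
begin

text \<open>
  Nodes are the vertices of a finite digraph without parallel arcs, edges are pairs
  \<open>(m, n)\<close>. Vectors indexed by nodes or edges are functions of which only the values
  on \<open>pverts G\<close> and \<open>parcs G\<close> matter.
\<close>

definition incidence :: "'v \<times> 'v \<Rightarrow> 'v \<Rightarrow> real" where
  "incidence l k = (if k = fst l then 1 else if k = snd l then - 1 else 0)"

text \<open>
  Walking along edges in either direction is walking in \<open>mk_symmetric G\<close>. There, an edge
  followed back and forth would count as a directed cycle; distinctness of the edges with
  their direction forgotten excludes it.
\<close>

definition undirected_cycle :: "'v pair_pre_digraph \<Rightarrow> ('v \<times> 'v) list \<Rightarrow> bool" where
  "undirected_cycle G p \<longleftrightarrow>
     pre_digraph.cycle (with_proj (mk_symmetric (with_proj G))) p \<and>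
     distinct (map (\<lambda>(u, v). {u, v}) p)"

text \<open>
  A cycle is identified with its set of edges, so that the choice of the starting node and of
  the direction of traversal does not matter.
\<close>

definition cycles :: "'v pair_pre_digraph \<Rightarrow> ('v \<times> 'v) set set" where
  "cycles G =
     {{l \<in> parcs G. l \<in> set p \<or> prod.swap l \<in> set p} | p. undirected_cycle G p}"

locale gas_network = pair_fin_digraph G
  for G :: "'v pair_pre_digraph" +
  fixes compressors :: "('v \<times> 'v) set"
    and \<alpha> a :: "'v \<times> 'v \<Rightarrow> real"
  assumes weakly_connected: "Digraph_Component.connected (with_proj G)"
    and oriented: "(m, n) \<in> parcs G \<Longrightarrow> (n, m) \<notin> parcs G"
    and compressors_subset: "compressors \<subseteq> parcs G"
    and \<alpha>_pos: "l \<in> compressors \<Longrightarrow> \<alpha> l > 0"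
    and a_pos: "l \<in> parcs G - compressors \<Longrightarrow> a l > 0"
    and compressor_followed_by_pipe:
      "(m, n) \<in> compressors \<Longrightarrow>
         \<exists>n'. (n, n') \<in> parcs G - compressors \<and>
              {l \<in> parcs G. fst l = n \<or> snd l = n} = {(m, n), (n, n')}"
begin

definition lossy_pipes :: "('v \<times> 'v) set" where
  "lossy_pipes = parcs G - compressors"

definition active_cycle :: "('v \<times> 'v) set \<Rightarrow> bool" where
  "active_cycle c \<longleftrightarrow> c \<in> cycles G \<and> c \<inter> compressors \<noteq> {}"

definition flow_balance :: "('v \<Rightarrow> real) \<Rightarrow> ('v \<times> 'v \<Rightarrow> real) \<Rightarrow> bool" where
  "flow_balance q \<phi> \<longleftrightarrow>
     (\<forall>n\<in>pverts G. (\<Sum>l\<in>parcs G. incidence l n * \<phi> l) = q n)"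

definition compressor_law :: "('v \<times> 'v \<Rightarrow> real) \<Rightarrow> ('v \<Rightarrow> real) \<Rightarrow> bool" where
  "compressor_law \<phi> \<psi> \<longleftrightarrow>
     (\<forall>(m, n)\<in>compressors. \<psi> n = \<alpha> (m, n) * \<psi> m \<and> \<phi> (m, n) \<ge> 0)"

definition pressure_drop_law :: "('v \<times> 'v \<Rightarrow> real) \<Rightarrow> ('v \<Rightarrow> real) \<Rightarrow> bool" where
  "pressure_drop_law \<phi> \<psi> \<longleftrightarrow>
     (\<forall>(m, n)\<in>lossy_pipes. \<psi> m - \<psi> n = a (m, n) * sgn (\<phi> (m, n)) * (\<phi> (m, n))\<^sup>2) \<and>
     (\<forall>n\<in>pverts G. \<psi> n \<ge> 0)"

definition r_objective :: "('v \<Rightarrow> real) \<Rightarrow> real" where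
  "r_objective \<psi> =
     (\<Sum>(m, n)\<in>{l \<in> lossy_pipes. \<not> (\<exists>c. active_cycle c \<and> l \<in> c)}. \<bar>\<psi> m - \<psi> n\<bar>)"

end

text \<open>
  \<open>\<psi>\<^sub>0\<close> carries the given pressures on \<open>N\<^sub>\<psi>\<close> and \<open>q\<^sub>0\<close> the given injections on the remaining
  nodes.
\<close>

locale gas_flow_problem = gas_network G compressors \<alpha> a
  for G :: "'v pair_pre_digraph" and compressors \<alpha> a +
  fixes N\<^sub>\<psi> :: "'v set"
    and \<psi>\<^sub>0 q\<^sub>0 :: "'v \<Rightarrow> real"
  assumes N\<^sub>\<psi>_subset: "N\<^sub>\<psi> \<subseteq> pverts G"
    and compressor_head_injection: "(m, n) \<in> compressors \<Longrightarrow> n \<notin> N\<^sub>\<psi> \<and> q\<^sub>0 n = 0"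
begin

definition agrees_with_data :: "('v \<Rightarrow> real) \<Rightarrow> ('v \<Rightarrow> real) \<Rightarrow> bool" where
  "agrees_with_data q \<psi> \<longleftrightarrow>
     (\<forall>n\<in>N\<^sub>\<psi>. \<psi> n = \<psi>\<^sub>0 n) \<and> (\<forall>n\<in>pverts G - N\<^sub>\<psi>. q n = q\<^sub>0 n)"

definition gas_flow_solution ::
  "('v \<Rightarrow> real) \<Rightarrow> ('v \<times> 'v \<Rightarrow> real) \<Rightarrow> ('v \<Rightarrow> real) \<Rightarrow> bool" where
  "gas_flow_solution q \<phi> \<psi> \<longleftrightarrow>
     agrees_with_data q \<psi> \<and> flow_balance q \<phi> \<and> pressure_drop_law \<phi> \<psi> \<and> compressor_law \<phi> \<psi>"

end

locale relaxed_gas_flow_problem = gas_flow_problem G compressors \<alpha> a N\<^sub>\<psi> \<psi>\<^sub>0 q\<^sub>0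
  for G :: "'v pair_pre_digraph" and compressors \<alpha> a N\<^sub>\<psi> \<psi>\<^sub>0 q\<^sub>0 +
  fixes \<psi>_lo \<psi>_up :: "'v \<Rightarrow> real"
    and \<phi>_up :: "'v \<times> 'v \<Rightarrow> real"
  assumes \<psi>_lo_nonneg: "n \<in> pverts G \<Longrightarrow> 0 \<le> \<psi>_lo n"
    and \<psi>_lo_le_up: "n \<in> pverts G \<Longrightarrow> \<psi>_lo n \<le> \<psi>_up n"
    and pressure_bounds_valid:
      "gas_flow_solution q \<phi> \<psi> \<Longrightarrow> n \<in> pverts G \<Longrightarrow> \<psi>_lo n \<le> \<psi> n \<and> \<psi> n \<le> \<psi>_up n"
    and flow_bounds_valid:
      "gas_flow_solution q \<phi> \<psi> \<Longrightarrow> l \<in> parcs G \<Longrightarrow> \<bar>\<phi> l\<bar> \<le> \<phi>_up l"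
begin

definition G2_feasible ::
  "('v \<Rightarrow> real) \<Rightarrow> ('v \<times> 'v \<Rightarrow> real) \<Rightarrow> ('v \<Rightarrow> real) \<Rightarrow> ('v \<times> 'v \<Rightarrow> real) \<Rightarrow>
   ('v \<times> 'v \<Rightarrow> 'v \<Rightarrow> real) \<Rightarrow> bool" where
  "G2_feasible q \<phi> \<psi> x z \<longleftrightarrow>
     agrees_with_data q \<psi> \<and> flow_balance q \<phi> \<and> compressor_law \<phi> \<psi> \<and>
     (\<forall>l\<in>lossy_pipes.
        x l \<in> {0, 1} \<and>
        (\<forall>k\<in>{fst l, snd l}.
           x l * \<psi>_lo k \<le> z l k \<and> z l k \<le> x l * \<psi>_up k \<and>
           \<psi> k + (x l - 1) * \<psi>_up k \<le> z l k \<and> z l k \<le> \<psi> k + (x l - 1) * \<psi>_lo k) \<and>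
        2 * z l (fst l) - 2 * z l (snd l) + \<psi> (snd l) - \<psi> (fst l) \<ge> a l * (\<phi> l)\<^sup>2 \<and>
        - \<phi>_up l * (1 - x l) \<le> \<phi> l \<and> \<phi> l \<le> \<phi>_up l * x l)"

definition G2_minimizer ::
  "('v \<Rightarrow> real) \<Rightarrow> ('v \<times> 'v \<Rightarrow> real) \<Rightarrow> ('v \<Rightarrow> real) \<Rightarrow> ('v \<times> 'v \<Rightarrow> real) \<Rightarrow>
   ('v \<times> 'v \<Rightarrow> 'v \<Rightarrow> real) \<Rightarrow> bool" where
  "G2_minimizer q \<phi> \<psi> x z \<longleftrightarrow>
     is_arg_min (\<lambda>(q, \<phi>, \<psi>, x, z). r_objective \<psi>)
       (\<lambda>(q, \<phi>, \<psi>, x, z). G2_feasible q \<phi> \<psi> x z) (q, \<phi>, \<psi>, x, z)"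

end

end

theory Submission
  imports Defs
begin

text \<open>
  The difference \<open>\<delta>\<close> between the flow of a minimizer and that of a gas flow solution is a
  circulation. Following its direction of flow one finds cycles in its support; as every edge is
  on at most one cycle, the support is a disjoint union of such cycles, which avoid all
  compressors, and \<open>sgn \<delta>\<close> is a circulation too. Summing pressure drops against \<open>sgn \<delta>\<close>
  therefore gives zero, so the drops along \<open>\<delta>\<close> and those against it have the same total. In
  the direction of \<open>\<delta>\<close> the minimizer has more flow than the solution, so its total drop along
  \<open>\<delta>\<close>, hence its objective, is strictly larger unless \<open>\<delta> = 0\<close>. With equal flows, optimality
  forces every relaxed pressure drop inequality to be tight.
\<close>

section \<open>Sequences, walks and a comparison of sums\<close>

text \<open>Take the least \<open>j\<close> whose value has occurred before: minimality rules out
  any repetition below \<open>j\<close>. This cuts a simple closed segment out of an infinite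
  walk.\<close>

lemma first_repetition:
  fixes s :: "nat \<Rightarrow> 'a"
  assumes "finite (range s)"
  obtains i j where "i < j" "s i = s j" "inj_on s {i..<j}"
proof -
  have "\<not> inj s"
    using assms finite_imageD infinite_UNIV_nat by blast
  then obtain a b where "s a = s b" "a \<noteq> b"
    unfolding inj_def by blast
  then have ex: "\<exists>j. \<exists>i<j. s i = s j"
    by (metis linorder_neqE_nat)
  define j where "j = (LEAST j. \<exists>i<j. s i = s j)"
  from LeastI_ex[OF ex] obtain i where i: "i < j" "s i = s j"
    unfolding j_def by blast
  have min: "\<not> (\<exists>i<k. s i = s k)" if "k < j" for k
    using not_less_Least that unfolding j_def by blast
  have "inj_on s {i..<j}"
    by (rule linorder_inj_onI') (use min in auto)
  with i that show ?thesis by blast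
qed

text \<open>The induction peels off the first edge, so \<open>t\<close> is generalised and the
  hypothesis is used for the sequence shifted by one.\<close>

lemma pcas_map_upt:
  "pcas (t 0) (map (\<lambda>k. (t k, t (Suc k))) [0..<n]) (t n)"
proof (induction n arbitrary: t)
  case (Suc n)
  show ?case
    using Suc[of "\<lambda>k. t (Suc k)"]
    by (simp add: upt_conv_Cons map_Suc_upt[symmetric] comp_def del: upt_Suc)
qed simp

lemma tl_pawalk_verts: "tl (pawalk_verts u p) = map snd p" if "pcas u p v"
proof -
  have "pawalk_verts u p = u # map snd p"
    using that by (induction p arbitrary: u) auto
  then show ?thesis by simp
qed

text \<open>Both \<open>g\<close> and \<open>g\<^sub>0\<close> sum to zero, so each sum of absolute
  values is twice the sum of positive parts, and these compare termwise: where \<open>f\<close> is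
  positive, the larger flow forces a larger drop; elsewhere \<open>f\<^sub>0\<close> is negative and
  the positive part of \<open>g\<^sub>0\<close> vanishes.\<close>

lemma sum_abs_less_of_larger_flow:
  fixes f f\<^sub>0 g g\<^sub>0 a :: "'b \<Rightarrow> real"
  assumes "finite S" "S \<noteq> {}"
    and a: "\<And>l. l \<in> S \<Longrightarrow> 0 < a l"
    and flow: "\<And>l. l \<in> S \<Longrightarrow> f\<^sub>0 l < f l"
    and g\<^sub>0: "\<And>l. l \<in> S \<Longrightarrow> g\<^sub>0 l = a l * sgn (f\<^sub>0 l) * (f\<^sub>0 l)\<^sup>2"
    and g: "\<And>l. l \<in> S \<Longrightarrow>
      0 \<le> f l \<and> a l * (f l)\<^sup>2 \<le> g l \<or> f l \<le> 0 \<and> a l * (f l)\<^sup>2 \<le> - g l"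
    and "sum g S = 0" "sum g\<^sub>0 S = 0"
  shows "(\<Sum>l\<in>S. \<bar>g\<^sub>0 l\<bar>) < (\<Sum>l\<in>S. \<bar>g l\<bar>)"
proof -
  have abs_eq: "\<bar>y\<bar> = 2 * max y 0 - y" for y :: real by auto
  have strict: "max (g\<^sub>0 l) 0 < max (g l) 0" if l: "l \<in> S" "0 < f l" for l
  proof -
    have pos: "0 < a l * (f l)\<^sup>2" using a l by simp
    have gl: "a l * (f l)\<^sup>2 \<le> g l" using g[of l] l by auto
    show ?thesis
    proof (cases "0 < f\<^sub>0 l")
      case True
      then have "(f\<^sub>0 l)\<^sup>2 < (f l)\<^sup>2"
        using flow[of l] l by (intro power_strict_mono) auto
      then have "a l * (f\<^sub>0 l)\<^sup>2 < a l * (f l)\<^sup>2" using a l by simp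
      then show ?thesis using g\<^sub>0[of l] True gl l pos by auto
    next
      case False
      then have "g\<^sub>0 l \<le> 0"
        using g\<^sub>0[of l] a[of l] l by (auto simp: sgn_real_def)
      then show ?thesis using pos gl by auto
    qed
  qed
  have le: "max (g\<^sub>0 l) 0 \<le> max (g l) 0" if l: "l \<in> S" for l
  proof (cases "0 < f l")
    case False
    then have "g\<^sub>0 l \<le> 0"
      using flow[of l] g\<^sub>0[of l] a[of l] l by (auto simp: sgn_real_def)
    then show ?thesis by simp
  qed (use strict l in fastforce)
  \<comment> \<open>Source of strictness: drops that sum to zero cannot all be negative, and where
    \<open>f\<^sub>0\<close> is nonnegative \<open>f\<close> is positive.\<close>
  have "\<exists>l\<in>S. 0 \<le> f\<^sub>0 l"
  proof (rule ccontr)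
    assume "\<not> ?thesis"
    then have "g\<^sub>0 l < 0" if "l \<in> S" for l
      using that g\<^sub>0[of l] a[of l] by (auto simp: sgn_real_def)
    then have "sum g\<^sub>0 S < sum (\<lambda>_. 0) S"
      using assms by (intro sum_strict_mono) auto
    with \<open>sum g\<^sub>0 S = 0\<close> show False by simp
  qed
  then have "\<exists>l\<in>S. max (g\<^sub>0 l) 0 < max (g l) 0"
    using strict flow by force
  then have "(\<Sum>l\<in>S. max (g\<^sub>0 l) 0) < (\<Sum>l\<in>S. max (g l) 0)"
    using le \<open>finite S\<close> by (intro sum_strict_mono_ex1) auto
  then show ?thesis
    using assms by (simp add: abs_eq sum_subtractf flip: sum_distrib_left)
qed

section \<open>Flow balance and potentials\<close>

context gas_network
begin

lemma no_loops: "(u, u) \<notin> parcs G"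
  using oriented by blast

text \<open>Rests on the absence of loops, at which \<open>incidence\<close> would be 1 instead of
  0.\<close>

lemma incidence_eq:
  "l \<in> parcs G \<Longrightarrow> incidence l n = of_bool (n = fst l) - of_bool (n = snd l)"
  using no_loops by (cases l) (auto simp: incidence_def)

lemma sum_incidence_potential:
  assumes "l \<in> parcs G"
  shows "(\<Sum>n\<in>pverts G. incidence l n * f n) = f (fst l) - f (snd l)"
proof -
  have "(\<Sum>n\<in>pverts G. incidence l n * f n) =
      (\<Sum>n\<in>pverts G. if n = fst l then f n else 0) - (\<Sum>n\<in>pverts G. if n = snd l then f n else 0)"
    unfolding sum_subtractf[symmetric]
    by (rule sum.cong) (auto simp: incidence_eq[OF assms])
  then show ?thesis
    using assms pair_finite_verts arc_fst_in_verts arc_snd_in_verts by simp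
qed

text \<open>Summation by parts: exchange the sums over edges and nodes. For a circulation it makes
  weighted potential differences cancel; for constant \<open>f\<close> it makes the injections sum
  to zero.\<close>

lemma flow_balance_potential:
  assumes "flow_balance q \<phi>"
  shows "(\<Sum>l\<in>parcs G. \<phi> l * (f (fst l) - f (snd l))) = (\<Sum>n\<in>pverts G. q n * f n)"
proof -
  have "(\<Sum>l\<in>parcs G. \<phi> l * (f (fst l) - f (snd l))) =
      (\<Sum>l\<in>parcs G. \<Sum>n\<in>pverts G. incidence l n * \<phi> l * f n)"
    by (rule sum.cong)
      (auto simp: sum_incidence_potential[symmetric] sum_distrib_left mult_ac)
  also have "\<dots> = (\<Sum>n\<in>pverts G. (\<Sum>l\<in>parcs G. incidence l n * \<phi> l) * f n)"
    by (subst sum.swap) (simp add: sum_distrib_right)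
  finally show ?thesis
    using assms by (simp add: flow_balance_def)
qed

lemma flow_balance_add_mult:
  assumes "flow_balance q \<phi>" "flow_balance q' \<phi>'"
  shows "flow_balance (\<lambda>n. q n + c * q' n) (\<lambda>l. \<phi> l + c * \<phi>' l)"
  using assms
  by (simp add: flow_balance_def algebra_simps sum.distrib flip: sum_distrib_left)

lemma flow_balance_cong:
  assumes "\<And>l. l \<in> parcs G \<Longrightarrow> \<phi> l = \<phi>' l" "\<And>n. n \<in> pverts G \<Longrightarrow> q n = q' n"
  shows "flow_balance q \<phi> \<longleftrightarrow> flow_balance q' \<phi>'"
  using assms by (simp add: flow_balance_def)

section \<open>Directed cycles in the support of a circulation\<close>

text \<open>Reorients the support of \<open>\<delta>\<close> along the actual direction of
  flow.\<close>

definition carries :: "('v \<times> 'v \<Rightarrow> real) \<Rightarrow> 'v \<Rightarrow> 'v \<Rightarrow> bool" where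
  "carries \<delta> u v \<longleftrightarrow>
     (u, v) \<in> parcs G \<and> \<delta> (u, v) > 0 \<or> (v, u) \<in> parcs G \<and> \<delta> (v, u) < 0"

lemma carries_asym: "carries \<delta> u v \<Longrightarrow> \<not> carries \<delta> v u"
  using oriented by (fastforce simp: carries_def)

lemma carries_irrefl: "\<not> carries \<delta> u u"
  using carries_asym by blast

lemma carries_in_verts:
  assumes "carries \<delta> u v" shows "u \<in> pverts G" "v \<in> pverts G"
  using assms in_arcsD1 in_arcsD2 by (auto simp: carries_def)

text \<open>What enters \<open>v\<close> must leave it: without an outgoing edge all terms of the
  balance at \<open>v\<close> are nonpositive, and the one coming from \<open>u\<close> is
  negative.\<close>

lemma carries_continues:
  assumes bal: "flow_balance (\<lambda>_. 0) \<delta>" and uv: "carries \<delta> u v"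
  shows "\<exists>w. carries \<delta> v w"
proof (rule ccontr)
  assume none: "\<nexists>w. carries \<delta> v w"
  have le: "incidence l v * \<delta> l \<le> 0" if "l \<in> parcs G" for l
    using that none by (cases l) (auto simp: incidence_def carries_def not_less)
  have "\<exists>l\<in>parcs G. incidence l v * \<delta> l < 0"
    using uv no_loops by (force simp: incidence_def carries_def)
  then have "(\<Sum>l\<in>parcs G. incidence l v * \<delta> l) < (\<Sum>l\<in>parcs G. 0)"
    using le pair_finite_arcs by (intro sum_strict_mono_ex1) auto
  moreover have "(\<Sum>l\<in>parcs G. incidence l v * \<delta> l) = 0"
    using bal carries_in_verts[OF uv] by (simp add: flow_balance_def)
  ultimately show False by simp
qed

text \<open>Only \<open>t 0\<close> to \<open>t n\<close> matter. Lengths one and two are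
  impossible, as \<open>carries\<close> is irreflexive and asymmetric.\<close>

definition flow_cycle :: "('v \<times> 'v \<Rightarrow> real) \<Rightarrow> (nat \<Rightarrow> 'v) \<Rightarrow> nat \<Rightarrow> bool" where
  "flow_cycle \<delta> t n \<longleftrightarrow>
     0 < n \<and> t n = t 0 \<and> inj_on t {..<n} \<and> (\<forall>k<n. carries \<delta> (t k) (t (Suc k)))"

lemma flow_cycle_exists:
  assumes bal: "flow_balance (\<lambda>_. 0) \<delta>" and "l \<in> parcs G" "\<delta> l \<noteq> 0"
  obtains t n where "flow_cycle \<delta> t n"
proof -
  have "carries \<delta> (fst l) (snd l) \<or> carries \<delta> (snd l) (fst l)"
    using assms(2,3) by (auto simp: carries_def)
  then obtain u v where uv: "carries \<delta> u v" by blast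
  \<comment> \<open>Follow the flow forever; the invariant that the current node has a successor
    lets dependent choice proceed.\<close>
  have "\<exists>s. \<forall>k. (\<exists>w. carries \<delta> (s k) w) \<and> carries \<delta> (s k) (s (Suc k))"
    by (rule dependent_nat_choice) (use uv carries_continues[OF bal] in blast)+
  then obtain s where s: "\<And>k. carries \<delta> (s k) (s (Suc k))" by blast
  have "finite (range s)"
    by (rule finite_subset[OF _ pair_finite_verts]) (use carries_in_verts(1)[OF s] in auto)
  then obtain i j where ij: "i < j" "s i = s j" "inj_on s {i..<j}"
    by (rule first_repetition)
  have "inj_on (\<lambda>k. s (i + k)) {..<j - i}"
    by (rule inj_onI) (use inj_onD[OF ij(3)] in fastforce)
  then have "flow_cycle \<delta> (\<lambda>k. s (i + k)) (j - i)"
    using ij s by (simp add: flow_cycle_def)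
  then show ?thesis by (rule that)
qed

section \<open>Flow cycles as network cycles and as unit circulations\<close>

definition walk_edges :: "(nat \<Rightarrow> 'v) \<Rightarrow> nat \<Rightarrow> ('v \<times> 'v) set" where
  "walk_edges t n =
     {l \<in> parcs G. \<exists>k<n. l = (t k, t (Suc k)) \<or> l = (t (Suc k), t k)}"

lemma walk_edges_in_cycles:
  assumes "flow_cycle \<delta> t n"
  shows "walk_edges t n \<in> cycles G"
proof -
  have n: "0 < n" and closed: "t n = t 0" and inj: "inj_on t {..<n}"
    and step: "\<And>k. k < n \<Longrightarrow> carries \<delta> (t k) (t (Suc k))"
    using assms by (auto simp: flow_cycle_def)
  define p where "p = map (\<lambda>k. (t k, t (Suc k))) [0..<n]"
  let ?H = "mk_symmetric (with_proj G)"
  have cas: "pcas (t 0) p (t 0)"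
    using pcas_map_upt[of t n] closed by (simp add: p_def)
  \<comment> \<open>The library wants the heads \<open>t 1\<close> to \<open>t n\<close> distinct,
    while injectivity is known for \<open>t 0\<close> to \<open>t (n - 1)\<close>; index
    \<open>n\<close> is wrapped to 0.\<close>
  have inj': "inj_on (\<lambda>k. t (Suc k)) {..<n}"
  proof (rule inj_onI)
    fix i j assume *: "i \<in> {..<n}" "j \<in> {..<n}" "t (Suc i) = t (Suc j)"
    define i' where "i' = (if Suc i = n then 0 else Suc i)"
    define j' where "j' = (if Suc j = n then 0 else Suc j)"
    have "t i' = t j'" "i' < n" "j' < n"
      using * closed n by (auto simp: i'_def j'_def)
    then have "i' = j'" using inj by (auto simp: inj_on_def)
    then show "i = j" by (auto simp: i'_def j'_def split: if_splits)
  qed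
  have arcs: "set p \<subseteq> parcs ?H"
  proof
    fix l assume "l \<in> set p"
    then obtain k where "k < n" "l = (t k, t (Suc k))" by (auto simp: p_def)
    with step[of k] show "l \<in> parcs ?H"
      by (auto simp: parcs_mk_symmetric carries_def intro: rev_bexI)
  qed
  have "pre_digraph.cycle (with_proj ?H) p"
    unfolding pre_digraph.cycle_def pre_digraph.awalk_def awalk_verts_with_proj_eq cas_with_proj_eq
  proof (intro exI[of _ "t 0"] conjI)
    show "t 0 \<in> verts (with_proj ?H)"
      using carries_in_verts(1)[OF step[OF n]] by simp
    show "distinct (tl (pawalk_verts (t 0) p))"
      unfolding tl_pawalk_verts[OF cas]
      using inj' by (simp add: p_def distinct_map comp_def lessThan_atLeast0)
  qed (use arcs cas n in \<open>auto simp: p_def\<close>)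
  moreover have "distinct (map (\<lambda>(u, v). {u, v}) p)"
  proof -
    have "inj_on (\<lambda>k. {t k, t (Suc k)}) {..<n}"
    proof (rule inj_onI)
      fix i j assume *: "i \<in> {..<n}" "j \<in> {..<n}" "{t i, t (Suc i)} = {t j, t (Suc j)}"
      \<comment> \<open>A crosswise match would be an edge that carries flow in both
        directions.\<close>
      then have "\<not> (t i = t (Suc j) \<and> t (Suc i) = t j)"
        using carries_asym[OF step[of i]] step[of j] by (metis lessThan_iff)
      with * have "t i = t j" by (metis doubleton_eq_iff)
      with * inj show "i = j" by (auto simp: inj_on_def)
    qed
    then show ?thesis
      by (simp add: p_def distinct_map comp_def lessThan_atLeast0)
  qed
  ultimately have "undirected_cycle G p"
    by (simp add: undirected_cycle_def)
  moreover have "walk_edges t n = {l \<in> parcs G. l \<in> set p \<or> prod.swap l \<in> set p}"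
    by (auto simp: walk_edges_def p_def)
  ultimately show ?thesis
    unfolding cycles_def by blast
qed

text \<open>The signed number of traversals of an edge, that is, one unit of flow sent along the
  walk.\<close>

definition walk_flow :: "(nat \<Rightarrow> 'v) \<Rightarrow> nat \<Rightarrow> 'v \<times> 'v \<Rightarrow> real" where
  "walk_flow t n l =
     (\<Sum>k<n. of_bool (l = (t k, t (Suc k))) - of_bool (l = (t (Suc k), t k)))"

lemma flow_balance_walk_flow:
  assumes "flow_cycle \<delta> t n"
  shows "flow_balance (\<lambda>_. 0) (walk_flow t n)"
  unfolding flow_balance_def
proof
  fix m assume "m \<in> pverts G"
  have closed: "t n = t 0" and step: "\<And>k. k < n \<Longrightarrow> carries \<delta> (t k) (t (Suc k))"
    using assms by (auto simp: flow_cycle_def)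
  let ?e = "\<lambda>k. of_bool (m = t k) :: real"
  \<comment> \<open>A step from \<open>u\<close> to \<open>v\<close> has the same effect on the
    balance whichever way its edge is oriented, so the steps telescope around the closed
    walk.\<close>
  have single: "(\<Sum>l\<in>parcs G. incidence l m * (of_bool (l = (u, v)) - of_bool (l = (v, u)))) =
      of_bool (m = u) - of_bool (m = v)" if c: "carries \<delta> u v" for u v
  proof -
    have "(\<Sum>l\<in>parcs G. incidence l m * (of_bool (l = (u, v)) - of_bool (l = (v, u)))) =
        (\<Sum>l\<in>parcs G. if l = (u, v) then incidence l m else 0) -
        (\<Sum>l\<in>parcs G. if l = (v, u) then incidence l m else 0)"
      by (simp only: right_diff_distrib sum_subtractf of_bool_def if_distrib[of "(*) _"]
          mult_1_right mult_zero_right)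
    also have "\<dots> =
        (if (u, v) \<in> parcs G then incidence (u, v) m else 0) -
        (if (v, u) \<in> parcs G then incidence (v, u) m else 0)"
      by (simp add: pair_finite_arcs)
    also have "\<dots> = of_bool (m = u) - of_bool (m = v)"
      using c oriented[of u v] oriented[of v u] by (auto simp: carries_def incidence_eq)
    finally show ?thesis .
  qed
  have "(\<Sum>l\<in>parcs G. incidence l m * walk_flow t n l) = (\<Sum>k<n. ?e k - ?e (Suc k))"
    unfolding walk_flow_def sum_distrib_left
    by (subst sum.swap) (simp add: single step)
  also have "\<dots> = 0"
    unfolding sum_lessThan_telescope'[of ?e] using closed by simp
  finally show "(\<Sum>l\<in>parcs G. incidence l m * walk_flow t n l) = 0" .
qed

lemma flow_cycle_edge_nonzero:
  assumes "flow_cycle \<delta> t n" "l \<in> walk_edges t n"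
  shows "\<delta> l \<noteq> 0"
proof -
  obtain k where "carries \<delta> (t k) (t (Suc k))" "l = (t k, t (Suc k)) \<or> l = (t (Suc k), t k)"
    using assms by (auto simp: flow_cycle_def walk_edges_def)
  moreover have "l \<in> parcs G"
    using assms(2) by (simp add: walk_edges_def)
  ultimately show ?thesis
    using oriented by (auto simp: carries_def)
qed

text \<open>A flow cycle uses each of its edges exactly once and in the direction of
  \<open>\<delta>\<close>, so a single summand survives and equals the sign.\<close>

lemma walk_flow_eq:
  assumes cyc: "flow_cycle \<delta> t n" and l: "l \<in> parcs G"
  shows "walk_flow t n l = (if l \<in> walk_edges t n then sgn (\<delta> l) else 0)"
proof (cases "l \<in> walk_edges t n")
  case False
  then show ?thesis
    using l by (auto simp: walk_flow_def walk_edges_def intro!: sum.neutral)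
next
  case True
  have inj: "inj_on t {..<n}" and step: "\<And>k. k < n \<Longrightarrow> carries \<delta> (t k) (t (Suc k))"
    using cyc by (auto simp: flow_cycle_def)
  obtain k where k: "k < n" and lk: "l = (t k, t (Suc k)) \<or> l = (t (Suc k), t k)"
    using True by (auto simp: walk_edges_def)
  let ?s = "\<lambda>j. of_bool (l = (t j, t (Suc j))) - of_bool (l = (t (Suc j), t j)) :: real"
  have "?s j = 0" if "j < n" "j \<noteq> k" for j
  proof -
    have "t j \<noteq> t k" using inj that k by (auto simp: inj_on_def)
    moreover have "\<not> (t k = t (Suc j) \<and> t (Suc k) = t j)"
      using carries_asym[OF step[OF k]] step[OF \<open>j < n\<close>] by auto
    ultimately show ?thesis using lk by auto
  qed
  then have "walk_flow t n l = ?s k"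
    unfolding walk_flow_def using k
    by (subst sum.remove[of _ k]) (auto intro!: sum.neutral)
  also have "\<dots> = sgn (\<delta> l)"
    using step[OF k] lk l oriented carries_irrefl by (fastforce simp: carries_def)
  finally show ?thesis using True by simp
qed

section \<open>The sign of a circulation\<close>

text \<open>Induction on the size of the support, removing one flow cycle at a time. The second
  conjunct is carried along because the induction step uses it to see that the remaining support is
  disjoint from the removed cycle.\<close>

lemma sgn_circulation:
  assumes one_cycle: "\<And>l c c'. l \<in> parcs G \<Longrightarrow> c \<in> cycles G \<Longrightarrow> c' \<in> cycles G \<Longrightarrow>
      l \<in> c \<Longrightarrow> l \<in> c' \<Longrightarrow> c = c'"
    and "flow_balance (\<lambda>_. 0) \<delta>"
  shows "flow_balance (\<lambda>_. 0) (\<lambda>l. sgn (\<delta> l)) \<and>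
    (\<forall>l\<in>parcs G. \<delta> l \<noteq> 0 \<longrightarrow> (\<exists>c\<in>cycles G. l \<in> c \<and> (\<forall>l'\<in>c. \<delta> l' \<noteq> 0)))"
  using assms(2)
proof (induction "card {l \<in> parcs G. \<delta> l \<noteq> 0}" arbitrary: \<delta> rule: less_induct)
  case less
  note bal = less.prems
  show ?case
  proof (cases "\<exists>l\<in>parcs G. \<delta> l \<noteq> 0")
    case False
    then show ?thesis by (auto simp: flow_balance_def)
  next
    case True
    then obtain t n where cyc: "flow_cycle \<delta> t n"
      using flow_cycle_exists[OF bal] by blast
    define C where "C = walk_edges t n"
    have C: "C \<in> cycles G" "C \<subseteq> parcs G"
      using walk_edges_in_cycles[OF cyc] by (auto simp: C_def walk_edges_def)
    have nz: "\<delta> l \<noteq> 0" if "l \<in> C" for l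
      using flow_cycle_edge_nonzero[OF cyc] that by (simp add: C_def)
    have \<chi>: "walk_flow t n l = (if l \<in> C then sgn (\<delta> l) else 0)" if "l \<in> parcs G" for l
      using walk_flow_eq[OF cyc that] by (simp add: C_def)
    have "C \<noteq> {}"
      using cyc by (force simp: C_def walk_edges_def flow_cycle_def carries_def)
    moreover have finC: "finite C"
      using C pair_finite_arcs finite_subset by blast
    ultimately obtain e where e: "e \<in> C" "\<And>l. l \<in> C \<Longrightarrow> \<bar>\<delta> e\<bar> \<le> \<bar>\<delta> l\<bar>"
      using arg_min_if_finite[of C "\<lambda>l. \<bar>\<delta> l\<bar>"] by (metis not_le)
    \<comment> \<open>Pushing \<open>\<bar>\<delta> e\<bar>\<close> back around \<open>C\<close>
      cancels the flow on \<open>e\<close>; no edge joins the support, as \<open>\<delta>\<close> is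
      already nonzero on \<open>C\<close>.\<close>
    define \<delta>' where "\<delta>' = (\<lambda>l. \<delta> l + (- \<bar>\<delta> e\<bar>) * walk_flow t n l)"
    have bal': "flow_balance (\<lambda>_. 0) \<delta>'"
      using flow_balance_add_mult[OF bal flow_balance_walk_flow[OF cyc], of "- \<bar>\<delta> e\<bar>"]
      by (simp add: \<delta>'_def)
    have \<delta>'_eq: "\<delta>' l = (if l \<in> C then \<delta> l - \<bar>\<delta> e\<bar> * sgn (\<delta> l) else \<delta> l)"
      if "l \<in> parcs G" for l
      using \<chi>[OF that] by (simp add: \<delta>'_def)
    have supp: "\<delta> l \<noteq> 0" if "l \<in> parcs G" "\<delta>' l \<noteq> 0" for l
      using that \<delta>'_eq[of l] nz[of l] by (auto split: if_splits)
    have e0: "\<delta>' e = 0"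
      using \<delta>'_eq[of e] e C by (auto simp: abs_mult_sgn)
    have "{l \<in> parcs G. \<delta>' l \<noteq> 0} \<subset> {l \<in> parcs G. \<delta> l \<noteq> 0}"
      using supp e0 e(1) C(2) nz by blast
    then have "card {l \<in> parcs G. \<delta>' l \<noteq> 0} < card {l \<in> parcs G. \<delta> l \<noteq> 0}"
      using pair_finite_arcs by (intro psubset_card_mono) auto
    note IH = less.hyps[OF this bal']
    \<comment> \<open>A cycle in the support of \<open>\<delta>'\<close> cannot share an edge with \<open>C\<close>: it would equal \<open>C\<close>, but
       \<open>\<delta>' e = 0\<close>.\<close>
    have \<delta>'_C: "\<delta>' l = 0" if "l \<in> C" for l
      using IH one_cycle[of l C] that C e(1) e0 by blast
    \<comment> \<open>On \<open>C\<close> the first summand vanishes, off \<open>C\<close> the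
      second one does.\<close>
    have "sgn (\<delta> l) = sgn (\<delta>' l) + 1 * walk_flow t n l" if "l \<in> parcs G" for l
      using \<chi>[OF that] \<delta>'_eq[OF that] \<delta>'_C[of l] by auto
    moreover have "flow_balance (\<lambda>_. 0) (\<lambda>l. sgn (\<delta>' l) + 1 * walk_flow t n l)"
      using flow_balance_add_mult[of "\<lambda>_. 0" "\<lambda>l. sgn (\<delta>' l)" "\<lambda>_. 0" "walk_flow t n" 1]
        IH flow_balance_walk_flow[OF cyc] by simp
    ultimately have "flow_balance (\<lambda>_. 0) (\<lambda>l. sgn (\<delta> l))"
      using flow_balance_cong[of "\<lambda>l. sgn (\<delta> l)"] by (metis (no_types, lifting))
    moreover have "\<exists>c\<in>cycles G. l \<in> c \<and> (\<forall>l'\<in>c. \<delta> l' \<noteq> 0)"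
      if l: "l \<in> parcs G" "\<delta> l \<noteq> 0" for l
    proof (cases "l \<in> C")
      case True
      then show ?thesis using C nz by blast
    next
      case False
      then have "\<delta>' l \<noteq> 0" using l \<delta>'_eq by simp
      then obtain c where c: "c \<in> cycles G" "l \<in> c" "\<forall>l'\<in>c. \<delta>' l' \<noteq> 0"
        using IH l by blast
      have "c \<subseteq> parcs G" using c(1) by (auto simp: cycles_def)
      then show ?thesis using c supp by blast
    qed
    ultimately show ?thesis by blast
  qed
qed

text \<open>The first step of an undirected path from \<open>n\<close> to \<open>m\<close> is such
  an edge. It serves to reach every node when pressures are shown to be nonnegative.\<close>

lemma incident_edge_exists:
  assumes "n \<in> pverts G" "m \<in> pverts G" "n \<noteq> m"
  shows "\<exists>l\<in>parcs G. n = fst l \<or> n = snd l"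
proof -
  have "n \<rightarrow>\<^sup>*\<^bsub>with_proj (mk_symmetric (with_proj G))\<^esub> m"
    using weakly_connected assms
    by (auto simp: Digraph_Component.connected_def strongly_connected_def)
  then show ?thesis
    using assms(3)
    by (cases rule: pre_digraph.converse_reachable_cases)
      (force simp: parcs_mk_symmetric)+
qed

end

section \<open>Feasible points of the relaxation\<close>

context relaxed_gas_flow_problem
begin

text \<open>Makes a gas flow solution a competitor of the minimizer: \<open>x\<close> records the
  direction of flow and \<open>z\<close> is the exact product.\<close>

lemma gas_flow_solution_G2_feasible:
  assumes sol: "gas_flow_solution q \<phi> \<psi>"
  shows "\<exists>x z. G2_feasible q \<phi> \<psi> x z"
proof -
  define x :: "'v \<times> 'v \<Rightarrow> real" where "x = (\<lambda>l. of_bool (0 \<le> \<phi> l))"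
  define z where "z = (\<lambda>l k. x l * \<psi> k)"
  have pipe: "x l \<in> {0, 1} \<and>
        (\<forall>k\<in>{fst l, snd l}.
           x l * \<psi>_lo k \<le> z l k \<and> z l k \<le> x l * \<psi>_up k \<and>
           \<psi> k + (x l - 1) * \<psi>_up k \<le> z l k \<and> z l k \<le> \<psi> k + (x l - 1) * \<psi>_lo k) \<and>
        2 * z l (fst l) - 2 * z l (snd l) + \<psi> (snd l) - \<psi> (fst l) \<ge> a l * (\<phi> l)\<^sup>2 \<and>
        - \<phi>_up l * (1 - x l) \<le> \<phi> l \<and> \<phi> l \<le> \<phi>_up l * x l" if l: "l \<in> lossy_pipes" for l
  proof -
    have lG: "l \<in> parcs G" using l by (simp add: lossy_pipes_def)
    have drop: "\<psi> (fst l) - \<psi> (snd l) = a l * sgn (\<phi> l) * (\<phi> l)\<^sup>2"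
      using sol l by (auto simp: gas_flow_solution_def pressure_drop_law_def)
    have bounds: "\<psi>_lo k \<le> \<psi> k \<and> \<psi> k \<le> \<psi>_up k" if "k \<in> {fst l, snd l}" for k
      using pressure_bounds_valid[OF sol, of k] that lG arc_fst_in_verts arc_snd_in_verts
      by auto
    have flow: "\<bar>\<phi> l\<bar> \<le> \<phi>_up l" by (rule flow_bounds_valid[OF sol lG])
    show ?thesis
      using drop bounds flow by (auto simp: x_def z_def sgn_real_def split: if_splits)
  qed
  then show ?thesis
    using sol unfolding G2_feasible_def gas_flow_solution_def by blast
qed

text \<open>For binary \<open>x\<close> the bounds on \<open>z\<close> force
  \<open>z l k = x l * \<psi> k\<close>, so \<open>x l = 1\<close> gives the first alternative and
  \<open>x l = 0\<close> the second. They also give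
  \<open>\<psi>_lo k \<le> \<psi> k\<close>.\<close>

lemma G2_feasible_pipe:
  assumes "G2_feasible q \<phi> \<psi> x z" "l \<in> lossy_pipes"
  shows "0 \<le> \<phi> l \<and> a l * (\<phi> l)\<^sup>2 \<le> \<psi> (fst l) - \<psi> (snd l) \<or>
      \<phi> l \<le> 0 \<and> a l * (\<phi> l)\<^sup>2 \<le> \<psi> (snd l) - \<psi> (fst l)"
    and "k \<in> {fst l, snd l} \<Longrightarrow> 0 \<le> \<psi> k"
proof -
  have x: "x l \<in> {0, 1}"
    and z: "\<And>k. k \<in> {fst l, snd l} \<Longrightarrow>
      x l * \<psi>_lo k \<le> z l k \<and> z l k \<le> x l * \<psi>_up k \<and>
      \<psi> k + (x l - 1) * \<psi>_up k \<le> z l k \<and> z l k \<le> \<psi> k + (x l - 1) * \<psi>_lo k"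
    and drop: "2 * z l (fst l) - 2 * z l (snd l) + \<psi> (snd l) - \<psi> (fst l) \<ge> a l * (\<phi> l)\<^sup>2"
    and flow: "- \<phi>_up l * (1 - x l) \<le> \<phi> l" "\<phi> l \<le> \<phi>_up l * x l"
    using assms unfolding G2_feasible_def by blast+
  show "0 \<le> \<phi> l \<and> a l * (\<phi> l)\<^sup>2 \<le> \<psi> (fst l) - \<psi> (snd l) \<or>
      \<phi> l \<le> 0 \<and> a l * (\<phi> l)\<^sup>2 \<le> \<psi> (snd l) - \<psi> (fst l)"
    using x z[of "fst l"] z[of "snd l"] drop flow by auto
  assume k: "k \<in> {fst l, snd l}"
  then have "k \<in> pverts G"
    using assms(2) arc_fst_in_verts arc_snd_in_verts by (auto simp: lossy_pipes_def)
  then show "0 \<le> \<psi> k"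
    using x z[OF k] \<psi>_lo_nonneg[of k] by auto
qed

text \<open>The head of a compressor is the tail of a lossy pipe, where the pressure bounds apply;
  the positive factor passes the sign on to the tail of the compressor.\<close>

lemma G2_feasible_nonneg:
  assumes feas: "G2_feasible q \<phi> \<psi> x z" and l: "l \<in> parcs G" and k: "k \<in> {fst l, snd l}"
  shows "0 \<le> \<psi> k"
proof (cases "l \<in> compressors")
  case False
  then show ?thesis
    using G2_feasible_pipe(2)[OF feas _ k] l by (simp add: lossy_pipes_def)
next
  case True
  obtain m n where mn: "l = (m, n)" by (cases l)
  then obtain n' where "(n, n') \<in> lossy_pipes"
    using compressor_followed_by_pipe[of m n] True unfolding lossy_pipes_def by blast
  from G2_feasible_pipe(2)[OF feas this, of n] have n: "0 \<le> \<psi> n"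
    by simp
  have "\<psi> n = \<alpha> l * \<psi> m"
    using feas True mn by (auto simp: G2_feasible_def compressor_law_def)
  then have "0 \<le> \<psi> m"
    using n \<alpha>_pos[OF True] by (simp add: zero_le_mult_iff)
  with n k mn show ?thesis by auto
qed

text \<open>The injections sum to zero, so the only free one, at \<open>r\<close>, is determined by
  the given ones.\<close>

lemma injections_unique:
  assumes "N\<^sub>\<psi> = {r}" "agrees_with_data q \<psi>" "agrees_with_data q' \<psi>'"
    and "flow_balance q \<phi>" "flow_balance q' \<phi>'" and n: "n \<in> pverts G"
  shows "q n = q' n"
proof -
  have "(\<Sum>n\<in>pverts G. q n) = 0" "(\<Sum>n\<in>pverts G. q' n) = 0"
    using flow_balance_potential[OF assms(4), of "\<lambda>_. 1"]
      flow_balance_potential[OF assms(5), of "\<lambda>_. 1"] by auto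
  moreover have off_r: "q n = q' n" if "n \<in> pverts G - {r}" for n
    using that assms(2,3) unfolding agrees_with_data_def by (simp add: assms(1))
  moreover have r: "r \<in> pverts G"
    using N\<^sub>\<psi>_subset assms(1) by simp
  ultimately have "q r = q' r"
    using sum.remove[OF pair_finite_verts r, of q] sum.remove[OF pair_finite_verts r, of q']
      sum.cong[OF refl off_r]
    by simp
  with off_r n show ?thesis by blast
qed

section \<open>Optimality forces a gas flow solution\<close>

lemma G2_minimizer_solves_gas_flow:
  assumes sol: "gas_flow_solution q\<^sub>s \<phi>\<^sub>s \<psi>\<^sub>s"
    and single: "N\<^sub>\<psi> = {r}"
    and one_cycle: "\<And>l c c'. l \<in> parcs G \<Longrightarrow> c \<in> cycles G \<Longrightarrow> c' \<in> cycles G \<Longrightarrow>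
      l \<in> c \<Longrightarrow> l \<in> c' \<Longrightarrow> c = c'"
    and no_comp: "\<And>l c. l \<in> compressors \<Longrightarrow> c \<in> cycles G \<Longrightarrow> l \<notin> c"
    and min: "G2_minimizer q \<phi> \<psi> x z"
  shows "gas_flow_solution q \<phi> \<psi>"
proof -
  have feas: "G2_feasible q \<phi> \<psi> x z"
    and le: "r_objective \<psi> \<le> r_objective \<psi>\<^sub>s"
    using min gas_flow_solution_G2_feasible[OF sol]
    by (fastforce simp: G2_minimizer_def is_arg_min_def not_less)+
  \<comment> \<open>Without compressors on cycles there is no active cycle, so no lossy pipe is left
    out.\<close>
  have obj: "r_objective \<psi> = (\<Sum>l\<in>lossy_pipes. \<bar>\<psi> (fst l) - \<psi> (snd l)\<bar>)" for \<psi>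
  proof -
    have "{l \<in> lossy_pipes. \<not> (\<exists>c. active_cycle c \<and> l \<in> c)} = lossy_pipes"
      using no_comp by (auto simp: active_cycle_def)
    then show ?thesis by (simp add: r_objective_def case_prod_unfold)
  qed
  have agrees: "agrees_with_data q \<psi>" "agrees_with_data q\<^sub>s \<psi>\<^sub>s"
    and bal: "flow_balance q \<phi>" "flow_balance q\<^sub>s \<phi>\<^sub>s"
    and comp: "compressor_law \<phi> \<psi>"
    using feas sol by (auto simp: G2_feasible_def gas_flow_solution_def)
  have q_eq: "q n = q\<^sub>s n" if "n \<in> pverts G" for n
    using injections_unique[OF single agrees bal that] .
  define \<delta> where "\<delta> = (\<lambda>l. \<phi> l - \<phi>\<^sub>s l)"
  define S where "S = {l \<in> parcs G. \<delta> l \<noteq> 0}"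
  have "flow_balance (\<lambda>_. 0) \<delta>"
    using flow_balance_add_mult[OF bal, of "- 1"] q_eq
    by (subst flow_balance_cong[of _ "\<lambda>l. \<phi> l + - 1 * \<phi>\<^sub>s l" _ "\<lambda>n. q n + - 1 * q\<^sub>s n"])
      (auto simp: \<delta>_def)
  note sgn_circ = sgn_circulation[OF one_cycle this]
  \<comment> \<open>Every edge of the support lies on a cycle, and compressors lie on none.\<close>
  have S_lossy: "S \<subseteq> lossy_pipes"
    using sgn_circ no_comp by (fastforce simp: S_def lossy_pipes_def)
  have fin: "finite lossy_pipes" "finite S"
    using pair_finite_arcs by (auto simp: lossy_pipes_def S_def)
  have loss: "0 < a l" if "l \<in> lossy_pipes" for l
    using that a_pos by (simp add: lossy_pipes_def)
  have drop\<^sub>s: "\<psi>\<^sub>s (fst l) - \<psi>\<^sub>s (snd l) = a l * sgn (\<phi>\<^sub>s l) * (\<phi>\<^sub>s l)\<^sup>2" if "l \<in> lossy_pipes" for l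
    using sol that by (auto simp: gas_flow_solution_def pressure_drop_law_def)
  note drop = G2_feasible_pipe(1)[OF feas]
  have abs_drop\<^sub>s: "\<bar>\<psi>\<^sub>s (fst l) - \<psi>\<^sub>s (snd l)\<bar> = a l * (\<phi>\<^sub>s l)\<^sup>2" if "l \<in> lossy_pipes" for l
    using drop\<^sub>s[OF that] loss[OF that] by (auto simp: sgn_real_def abs_mult)
  have abs_drop: "a l * (\<phi> l)\<^sup>2 \<le> \<bar>\<psi> (fst l) - \<psi> (snd l)\<bar>" if "l \<in> lossy_pipes" for l
    using drop[OF that] by auto
  have same: "\<phi> l = \<phi>\<^sub>s l" if "l \<in> lossy_pipes - S" for l
    using that by (auto simp: S_def \<delta>_def lossy_pipes_def)
  have off_S: "\<bar>\<psi>\<^sub>s (fst l) - \<psi>\<^sub>s (snd l)\<bar> \<le> \<bar>\<psi> (fst l) - \<psi> (snd l)\<bar>"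
    if "l \<in> lossy_pipes - S" for l
    using abs_drop[of l] abs_drop\<^sub>s[of l] same[OF that] that by simp
  have "S = {}"
  proof (rule ccontr)
    assume "S \<noteq> {}"
    have zero: "(\<Sum>l\<in>S. sgn (\<delta> l) * (f (fst l) - f (snd l))) = 0" for f
    proof -
      have "(\<Sum>l\<in>S. sgn (\<delta> l) * (f (fst l) - f (snd l))) =
          (\<Sum>l\<in>parcs G. sgn (\<delta> l) * (f (fst l) - f (snd l)))"
        by (rule sum.mono_neutral_left) (auto simp: S_def pair_finite_arcs)
      also have "\<dots> = 0"
        using flow_balance_potential[of "\<lambda>_. 0" "\<lambda>l. sgn (\<delta> l)" f] sgn_circ by simp
      finally show ?thesis .
    qed
    have sgn_cases: "sgn (\<delta> l) = 1 \<or> sgn (\<delta> l) = - 1" if "l \<in> S" for l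
      using that by (auto simp: S_def sgn_real_def)
    \<comment> \<open>Multiplying by \<open>sgn (\<delta> l)\<close> reorients each edge along
      \<open>\<delta>\<close>; the flow of the minimizer then exceeds that of the solution by
      \<open>\<bar>\<delta> l\<bar>\<close>.\<close>
    have "(\<Sum>l\<in>S. \<bar>sgn (\<delta> l) * (\<psi>\<^sub>s (fst l) - \<psi>\<^sub>s (snd l))\<bar>) <
        (\<Sum>l\<in>S. \<bar>sgn (\<delta> l) * (\<psi> (fst l) - \<psi> (snd l))\<bar>)"
    proof (rule sum_abs_less_of_larger_flow[where a = a and f = "\<lambda>l. sgn (\<delta> l) * \<phi> l"
          and f\<^sub>0 = "\<lambda>l. sgn (\<delta> l) * \<phi>\<^sub>s l"])
      fix l assume l: "l \<in> S"
      then have lossy: "l \<in> lossy_pipes" using S_lossy by blast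
      show "0 < a l" by (rule loss[OF lossy])
      show "sgn (\<delta> l) * \<phi>\<^sub>s l < sgn (\<delta> l) * \<phi> l"
        using l by (auto simp: S_def \<delta>_def sgn_real_def)
      show "sgn (\<delta> l) * (\<psi>\<^sub>s (fst l) - \<psi>\<^sub>s (snd l)) =
          a l * sgn (sgn (\<delta> l) * \<phi>\<^sub>s l) * (sgn (\<delta> l) * \<phi>\<^sub>s l)\<^sup>2"
        using sgn_cases[OF l] drop\<^sub>s[OF lossy] by (elim disjE) (simp_all add: algebra_simps)
      show "0 \<le> sgn (\<delta> l) * \<phi> l \<and>
            a l * (sgn (\<delta> l) * \<phi> l)\<^sup>2 \<le> sgn (\<delta> l) * (\<psi> (fst l) - \<psi> (snd l)) \<or>
          sgn (\<delta> l) * \<phi> l \<le> 0 \<and>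
            a l * (sgn (\<delta> l) * \<phi> l)\<^sup>2 \<le> - (sgn (\<delta> l) * (\<psi> (fst l) - \<psi> (snd l)))"
        using sgn_cases[OF l] drop[OF lossy] by auto
    qed (use \<open>S \<noteq> {}\<close> fin zero in auto)
    then have "(\<Sum>l\<in>S. \<bar>\<psi>\<^sub>s (fst l) - \<psi>\<^sub>s (snd l)\<bar>) < (\<Sum>l\<in>S. \<bar>\<psi> (fst l) - \<psi> (snd l)\<bar>)"
      by (simp add: abs_mult abs_sgn_eq S_def)
    moreover have "(\<Sum>l\<in>lossy_pipes - S. \<bar>\<psi>\<^sub>s (fst l) - \<psi>\<^sub>s (snd l)\<bar>) \<le>
        (\<Sum>l\<in>lossy_pipes - S. \<bar>\<psi> (fst l) - \<psi> (snd l)\<bar>)"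
      by (rule sum_mono) (rule off_S)
    ultimately have "r_objective \<psi>\<^sub>s < r_objective \<psi>"
      by (simp add: obj sum.subset_diff[OF S_lossy fin(1)])
    with le show False by simp
  qed
  then have same': "\<phi> l = \<phi>\<^sub>s l" if "l \<in> lossy_pipes" for l
    using same that by simp
  \<comment> \<open>With equal flows no drop is below that of the solution, so slack on one pipe
    would already raise the objective.\<close>
  have tight: "\<bar>\<psi> (fst l) - \<psi> (snd l)\<bar> = a l * (\<phi> l)\<^sup>2" if l: "l \<in> lossy_pipes" for l
  proof (rule ccontr)
    assume "\<not> ?thesis"
    then have "\<exists>l\<in>lossy_pipes. \<bar>\<psi>\<^sub>s (fst l) - \<psi>\<^sub>s (snd l)\<bar> < \<bar>\<psi> (fst l) - \<psi> (snd l)\<bar>"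
      using l abs_drop[OF l] abs_drop\<^sub>s[OF l] same'[OF l] by (intro bexI[of _ l]) auto
    then have "r_objective \<psi>\<^sub>s < r_objective \<psi>"
      unfolding obj using off_S \<open>S = {}\<close> fin by (intro sum_strict_mono_ex1) auto
    with le show False by simp
  qed
  \<comment> \<open>\<open>tight\<close> fixes the size of the drop, the alternatives in
    \<open>drop\<close> its sign.\<close>
  have "\<psi> (fst l) - \<psi> (snd l) = a l * sgn (\<phi> l) * (\<phi> l)\<^sup>2" if l: "l \<in> lossy_pipes" for l
  proof (cases "\<phi> l = 0")
    case True
    then show ?thesis using tight[OF l] by simp
  next
    case False
    then have "0 < a l * (\<phi> l)\<^sup>2" using loss[OF l] by simp
    then show ?thesis
      using drop[OF l] tight[OF l] False by (auto simp: sgn_real_def abs_if split: if_splits)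
  qed
  moreover have "0 \<le> \<psi> n" if n: "n \<in> pverts G" for n
  \<comment> \<open>The node \<open>r\<close> may be the whole network and have no incident edge,
    but its pressure is given and shared with the solution.\<close>
  proof (cases "n = r")
    case True
    then have "\<psi> n = \<psi>\<^sub>s n"
      using agrees unfolding agrees_with_data_def by (simp add: single)
    then show ?thesis
      using sol n by (simp add: gas_flow_solution_def pressure_drop_law_def)
  next
    case False
    then obtain l where "l \<in> parcs G" "n \<in> {fst l, snd l}"
      using incident_edge_exists[OF n, of r] N\<^sub>\<psi>_subset single by auto
    then show ?thesis by (rule G2_feasible_nonneg[OF feas])
  qed
  ultimately show ?thesis
    using agrees bal comp by (auto simp: gas_flow_solution_def pressure_drop_law_def)
qed

end

theorem corollary1:
  fixes G :: "'v pair_pre_digraph"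
    and compressors :: "('v \<times> 'v) set"
    and \<alpha> a \<phi>_up \<phi> x :: "'v \<times> 'v \<Rightarrow> real"
    and N\<^sub>\<psi> :: "'v set"
    and \<psi>\<^sub>0 q\<^sub>0 \<psi>_lo \<psi>_up q \<psi> :: "'v \<Rightarrow> real"
    and z :: "'v \<times> 'v \<Rightarrow> 'v \<Rightarrow> real"
    and r :: 'v
  assumes network: "relaxed_gas_flow_problem G compressors \<alpha> a N\<^sub>\<psi> \<psi>\<^sub>0 q\<^sub>0 \<psi>_lo \<psi>_up \<phi>_up"
    and feasible: "\<exists>q' \<phi>' \<psi>'.
      gas_flow_problem.gas_flow_solution G compressors \<alpha> a N\<^sub>\<psi> \<psi>\<^sub>0 q\<^sub>0 q' \<phi>' \<psi>'"
    and single_fixed_pressure: "N\<^sub>\<psi> = {r}"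
    and at_most_one_cycle:
      "\<forall>l\<in>parcs G. \<forall>c\<in>cycles G. \<forall>c'\<in>cycles G. l \<in> c \<and> l \<in> c' \<longrightarrow> c = c'"
    and no_compressor_on_cycle: "\<forall>l\<in>compressors. \<not> (\<exists>c\<in>cycles G. l \<in> c)"
    and minimizer: "relaxed_gas_flow_problem.G2_minimizer G compressors \<alpha> a N\<^sub>\<psi> \<psi>\<^sub>0 q\<^sub>0
      \<psi>_lo \<psi>_up \<phi>_up q \<phi> \<psi> x z"
  shows "gas_flow_problem.gas_flow_solution G compressors \<alpha> a N\<^sub>\<psi> \<psi>\<^sub>0 q\<^sub>0 q \<phi> \<psi>"
proof -
  interpret relaxed_gas_flow_problem G compressors \<alpha> a N\<^sub>\<psi> \<psi>\<^sub>0 q\<^sub>0 \<psi>_lo \<psi>_up \<phi>_up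
    by (rule network)
  obtain q\<^sub>s \<phi>\<^sub>s \<psi>\<^sub>s where "gas_flow_solution q\<^sub>s \<phi>\<^sub>s \<psi>\<^sub>s"
    using feasible by blast
  then show ?thesis
    using single_fixed_pressure
  proof (rule G2_minimizer_solves_gas_flow[OF _ _ _ _ minimizer])
    show "c = c'" if "l \<in> parcs G" "c \<in> cycles G" "c' \<in> cycles G" "l \<in> c" "l \<in> c'" for l c c'
      using at_most_one_cycle that by blast
    show "l \<notin> c" if "l \<in> compressors" "c \<in> cycles G" for l c
      using no_compressor_on_cycle that by blast
  qed
qed

end
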